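(* Let $n\ge1$. The following statistics are homomesic for permutations in $S_n$ with valley hopping, with the indicated average over every valley-hopping orbit: (1) the number of descents (average $\frac{n-1}{2}$); (2) the number of ascents (average $\frac{n-1}{2}$); (3) the width of the tree associated to the permutation (average $\frac{n+1}{2}$); (4) the number of runs (average $\frac{n+1}{2}$).
   Context: $[n]=\{1,\dots,n\}$; $S_n$ is the set of permutations of $[n]$, in one-line notation $\pi=\pi(1)\cdots\pi(n)$. Valley hopping: put $\pi(0)=\pi(n+1)=\infty$. With this convention an entry $x=\pi(i)$, $i\in[n]$, is a peak if $\pi(i-1)<\pi(i)>\pi(i+1)$, a valley if $\pi(i-1)>\pi(i)<\pi(i+1)$, a double ascent if $\pi(i-1)<\pi(i)<\pi(i+1)$, and a double descent if $\pi(i-1)>\pi(i)>\pi(i+1)$. For $x\in[n]$ write $\pi=w_1w_2\,x\,w_4w_5$, where $w_2$ (resp. $w_4$) is the maximal (possibly empty) contiguous subword immediately to the left (resp. right) of $x$ all of whose letters are smaller than $x$. Define $\varphi_x(\pi)=w_1w_4\,x\,w_2w_5$ if $x$ is a double ascent or double descent of $\pi$ (so $x$ hops across the adjacent valley), and $\varphi_x(\pi)=\pi$ if $x$ is a peak or a valley. The maps $\varphi_x$ are commuting involutions; for $S\subseteq[n]$ let $\varphi_S=\prod_{x\in S}\varphi_x$. The orbit of $\pi$ under valley hopping is $\{\varphi_S(\pi): S\subseteq[n]\}$. For example the orbit of $246135$ is $\{246135,426135,246315,246513,426315,426513,246531,426531\}$. A statistic is homomesic with average $c$ if its average over each orbit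 equals $c$. Statistics (no convention at infinity is used here): a descent (resp. ascent) is an $i\in[n-1]$ with $\pi(i)>\pi(i+1)$ (resp. $\pi(i)<\pi(i+1)$). A run is a maximal contiguous increasing subsequence of the one-line notation. The tree associated to $\pi$ is the rooted tree on $\{0,1,\dots,n\}$ with root $0$ in which the parent of $v\in[n]$ is the rightmost entry of $\pi$ that precedes $v$ in one-line notation and is smaller than $v$, or $0$ if there is no such entry; its width is its number of leaves. *)

theory Defs
  imports
    "HOL-Library.Extended_Nat"
    "HOL-Library.Sublist"
    "HOL-Combinatorics.Multiset_Permutations"
begin

text \<open>
  Permutations of \<open>[n]\<close> are lists in one-line notation, i.e. the elements of
  \<^term>\<open>permutations_of_set {1..n}\<close>.  Positions are counted from 1.
\<close>

definition letter :: "nat list \<Rightarrow> nat \<Rightarrow> nat" where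
  "letter \<pi> i = \<pi> ! (i - 1)"

text \<open>The convention \<open>\<pi>(0) = \<pi>(n+1) = \<infinity>\<close>, used for valley hopping only.\<close>

definition ext_letter :: "nat list \<Rightarrow> nat \<Rightarrow> enat" where
  "ext_letter \<pi> i = (if 1 \<le> i \<and> i \<le> length \<pi> then enat (letter \<pi> i) else \<infinity>)"

definition double_ascent :: "nat list \<Rightarrow> nat \<Rightarrow> bool" where
  "double_ascent \<pi> x \<longleftrightarrow> (\<exists>i\<in>{1..length \<pi>}. letter \<pi> i = x \<and>
     ext_letter \<pi> (i - 1) < ext_letter \<pi> i \<and> ext_letter \<pi> i < ext_letter \<pi> (i + 1))"

definition double_descent :: "nat list \<Rightarrow> nat \<Rightarrow> bool" where
  "double_descent \<pi> x \<longleftrightarrow> (\<exists>i\<in>{1..length \<pi>}. letter \<pi> i = x \<and>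
     ext_letter \<pi> (i - 1) > ext_letter \<pi> i \<and> ext_letter \<pi> i > ext_letter \<pi> (i + 1))"

text \<open>
  \<open>\<pi> = w1 @ w2 @ [x] @ w4 @ w5\<close>, where \<open>w2\<close> and \<open>w4\<close> are the maximal blocks of letters
  smaller than \<open>x\<close> adjacent to \<open>x\<close>.  A letter of a permutation that is neither a double
  ascent nor a double descent is a peak or a valley, and is left in place.
\<close>

definition hop :: "nat \<Rightarrow> nat list \<Rightarrow> nat list" where
  "hop x \<pi> =
    (if double_ascent \<pi> x \<or> double_descent \<pi> x then
       let l = takeWhile (\<lambda>y. y \<noteq> x) \<pi>;
           r = tl (dropWhile (\<lambda>y. y \<noteq> x) \<pi>);
           w1 = rev (dropWhile (\<lambda>y. y < x) (rev l));
           w2 = rev (takeWhile (\<lambda>y. y < x) (rev l));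
           w4 = takeWhile (\<lambda>y. y < x) r;
           w5 = dropWhile (\<lambda>y. y < x) r
       in w1 @ w4 @ [x] @ w2 @ w5
     else \<pi>)"

text \<open>
  The hops commute on permutations, so the order of composition is immaterial; increasing
  order of the letters is used.
\<close>

definition hop_set :: "nat set \<Rightarrow> nat list \<Rightarrow> nat list" where
  "hop_set S \<pi> = fold hop (sorted_list_of_set S) \<pi>"

definition hop_orbit :: "nat \<Rightarrow> nat list \<Rightarrow> nat list set" where
  "hop_orbit n \<pi> = {hop_set S \<pi> | S. S \<subseteq> {1..n}}"

definition homomesic :: "'a set \<Rightarrow> ('a \<Rightarrow> 'a set) \<Rightarrow> ('a \<Rightarrow> nat) \<Rightarrow> real \<Rightarrow> bool" where
  "homomesic X orbit f c \<longleftrightarrow>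
     (\<forall>x\<in>X. (\<Sum>y\<in>orbit x. real (f y)) / real (card (orbit x)) = c)"

definition descents :: "nat list \<Rightarrow> nat set" where
  "descents \<pi> = {i \<in> {1..length \<pi> - 1}. letter \<pi> i > letter \<pi> (i + 1)}"

definition ascents :: "nat list \<Rightarrow> nat set" where
  "ascents \<pi> = {i \<in> {1..length \<pi> - 1}. letter \<pi> i < letter \<pi> (i + 1)}"

text \<open>
  \<^const>\<open>sublist\<close> means contiguous subword.  Since the letters of a permutation are
  distinct, a nonempty contiguous subword determines its position.
\<close>

definition runs :: "nat list \<Rightarrow> nat list set" where
  "runs \<pi> = {w. sublist w \<pi> \<and> sorted_wrt (<) w \<and>
     (\<forall>v. sublist v \<pi> \<and> sorted_wrt (<) v \<and> sublist w v \<longrightarrow> v = w)}"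

definition tree_parent :: "nat list \<Rightarrow> nat \<Rightarrow> nat" where
  "tree_parent \<pi> v =
    (let s = filter (\<lambda>u. u < v) (takeWhile (\<lambda>u. u \<noteq> v) \<pi>)
     in if s = [] then 0 else last s)"

definition tree_vertices :: "nat list \<Rightarrow> nat set" where
  "tree_vertices \<pi> = {0..length \<pi>}"

text \<open>Edges are directed from parent to child; a leaf is a vertex without children.\<close>

definition tree_edges :: "nat list \<Rightarrow> (nat \<times> nat) set" where
  "tree_edges \<pi> = {(tree_parent \<pi> v, v) | v. v \<in> {1..length \<pi>}}"

definition tree_leaves :: "nat list \<Rightarrow> nat set" where
  "tree_leaves \<pi> = {u \<in> tree_vertices \<pi>. \<not> (\<exists>v. (u, v) \<in> tree_edges \<pi>)}"

definition tree_width :: "nat list \<Rightarrow> nat" where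
  "tree_width \<pi> = card (tree_leaves \<pi>)"

end

theory Submission
  imports Defs "HOL-Library.Tree"
begin

text \<open>
  A word with distinct letters is the inorder reading of a unique decreasing binary tree: the root
  is the largest letter, and the subtrees are built from the words to its left and right.  The
  blocks \<open>w2\<close> and \<open>w4\<close> around a letter \<open>x\<close> are the readings of the two subtrees below \<open>x\<close>, so
  \<open>x\<close> is a valley, a double ascent or descent, or a peak according to whether it has no, one or two
  children, and hopping \<open>x\<close> moves an only child to the other side
  (\<open>hop_inorder\<close>).  Acting on a set of letters is then a plain
  structural recursion on the tree (\<open>flip\<close>), from which the group law of the hops is immediate
  (\<open>flip_flip\<close>).

  A letter exceeds everything below it, so descents correspond to right children.  Letting
  all letters hop turns every only child around and leaves the nodes with two children alone; it
  therefore exchanges the number of right children with the number of left children.  Their sum is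
  the number of edges, \<open>n - 1\<close>.  Thus the hop of all letters is an involution \<open>\<Phi>\<close> of each orbit
  with \<open>des (\<Phi> \<pi>) + des \<pi> = n - 1\<close>, and averaging over the orbit gives \<open>(n - 1) / 2\<close>
  (\<open>homomesic_if_complementing_involution\<close>).  The other
  statistics are affine in the number of descents: ascents are the remaining \<open>n - 1 - des \<pi>\<close>
  positions, runs are cut at the descents, and the leaves of the rooted tree associated to \<open>\<pi>\<close>
  (which is not the decreasing tree above) are the descent tops together with the last letter.
\<close>

section \<open>Decreasing binary trees\<close>

fun decreasing :: "'a::linorder tree \<Rightarrow> bool" where
  "decreasing Leaf = True"
| "decreasing (Node l x r) =
     (decreasing l \<and> decreasing r \<and> (\<forall>y \<in> set_tree l \<union> set_tree r. y < x))"

lemma ex_decreasing_tree: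
  fixes xs :: "'a::linorder list"
  assumes "distinct xs"
  shows "\<exists>t. inorder t = xs \<and> decreasing t"
  using assms
proof (induction xs rule: length_induct)
  case (1 xs)
  show ?case
  proof (cases "xs = []")
    case True
    then have "inorder Leaf = xs \<and> decreasing (Leaf :: 'a tree)" by simp
    then show ?thesis by blast
  next
    case False
    define m where "m = Max (set xs)"
    have "m \<in> set xs" unfolding m_def using False by (intro Max_in) auto
    then obtain as bs where xs: "xs = as @ m # bs" by (meson split_list)
    have le: "y \<le> m" if "y \<in> set xs" for y using that by (simp add: m_def)
    obtain l where l: "inorder l = as" "decreasing l"
      using "1.IH"[rule_format, of as] "1.prems" unfolding xs by auto
    obtain r where r: "inorder r = bs" "decreasing r"
      using "1.IH"[rule_format, of bs] "1.prems" unfolding xs by auto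
    have "y < m" if "y \<in> set as \<union> set bs" for y
      using le[of y] that "1.prems" unfolding xs by (auto simp: less_le)
    then have "decreasing (Node l m r)" using l r set_inorder by force
    moreover have "inorder (Node l m r) = xs" using l r xs by simp
    ultimately show ?thesis by blast
  qed
qed

text \<open>
  Moving an only child to the other side, simultaneously at all nodes in \<open>S\<close>.  A childless
  node satisfies the condition too, but exchanging its empty subtrees changes nothing.
\<close>

fun flip :: "'a set \<Rightarrow> 'a tree \<Rightarrow> 'a tree" where
  "flip S Leaf = Leaf"
| "flip S (Node l x r) =
     (if x \<in> S \<and> (l = Leaf \<or> r = Leaf) then Node (flip S r) x (flip S l)
      else Node (flip S l) x (flip S r))"

lemma flip_eq_Leaf_iff [simp]: "flip S t = Leaf \<longleftrightarrow> t = Leaf"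
  by (cases t) auto

lemma set_tree_flip [simp]: "set_tree (flip S t) = set_tree t"
  by (induction t) (simp_all add: Un_commute)

lemma decreasing_flip: "decreasing t \<Longrightarrow> decreasing (flip S t)"
  by (induction t) auto

lemma distinct_inorder_flip: "distinct (inorder t) \<Longrightarrow> distinct (inorder (flip S t))"
  by (induction t) auto

lemma flip_disjoint: "S \<inter> set_tree t = {} \<Longrightarrow> flip S t = t"
  by (induction t) auto

lemma flip_flip: "flip S (flip T t) = flip ((S - T) \<union> (T - S)) t"
  by (induction t) auto

lemma flip_empty [simp]: "flip {} t = t"
  by (simp add: flip_disjoint)

lemma flip_involution [simp]: "flip S (flip S t) = t"
  by (simp add: flip_flip)

section \<open>Hopping as a flip of the decreasing tree\<close>

lemma ext_letter_at:
  "ext_letter (as @ x # bs) (Suc (length as)) = enat x"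
  by (simp add: ext_letter_def letter_def)

lemma ext_letter_before:
  "ext_letter (as @ x # bs) (length as) = (if as = [] then \<infinity> else enat (last as))"
  by (cases as rule: rev_cases) (simp_all add: ext_letter_def letter_def nth_append)

lemma ext_letter_after:
  "ext_letter (as @ x # bs) (Suc (Suc (length as))) = (if bs = [] then \<infinity> else enat (hd bs))"
  by (cases bs) (simp_all add: ext_letter_def letter_def nth_append)

lemma letter_eq_iff_position:
  assumes "distinct (as @ x # bs)" "i \<in> {1..length (as @ x # bs)}"
  shows "letter (as @ x # bs) i = x \<longleftrightarrow> i = Suc (length as)"
proof -
  have "letter (as @ x # bs) i = (as @ x # bs) ! length as \<longleftrightarrow> i - 1 = length as"
    unfolding letter_def using assms by (intro nth_eq_iff_index_eq) auto
  then show ?thesis using assms(2) by auto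
qed

lemma double_ascent_iff:
  assumes "distinct (as @ x # bs)"
  shows "double_ascent (as @ x # bs) x \<longleftrightarrow> (as \<noteq> [] \<and> last as < x) \<and> (bs = [] \<or> x < hd bs)"
proof -
  have "double_ascent (as @ x # bs) x \<longleftrightarrow>
    ext_letter (as @ x # bs) (length as) < enat x \<and>
    enat x < ext_letter (as @ x # bs) (Suc (Suc (length as)))"
    unfolding double_ascent_def
    using letter_eq_iff_position[OF assms] ext_letter_at[of as x bs]
    by (auto intro!: bexI[of _ "Suc (length as)"])
  then show ?thesis by (simp add: ext_letter_before ext_letter_after)
qed

lemma double_descent_iff:
  assumes "distinct (as @ x # bs)"
  shows "double_descent (as @ x # bs) x \<longleftrightarrow> (as = [] \<or> x < last as) \<and> (bs \<noteq> [] \<and> hd bs < x)"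
proof -
  have "double_descent (as @ x # bs) x \<longleftrightarrow>
    ext_letter (as @ x # bs) (length as) > enat x \<and>
    enat x > ext_letter (as @ x # bs) (Suc (Suc (length as)))"
    unfolding double_descent_def
    using letter_eq_iff_position[OF assms] ext_letter_at[of as x bs]
    by (auto intro!: bexI[of _ "Suc (length as)"])
  then show ?thesis by (simp add: ext_letter_before ext_letter_after)
qed

text \<open>
  The bounds on \<open>last w1\<close> and \<open>hd w5\<close> say that the blocks \<open>w2\<close> and \<open>w4\<close> are maximal, so these
  are the blocks that \<^const>\<open>hop\<close> computes.
\<close>

lemma hop_blocks:
  assumes dist: "distinct (w1 @ w2 @ x # w4 @ w5)"
    and w2: "\<forall>y \<in> set w2. y < x" and w4: "\<forall>y \<in> set w4. y < x"
    and w1: "w1 = [] \<or> x < last w1" and w5: "w5 = [] \<or> x < hd w5"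
  shows "hop x (w1 @ w2 @ x # w4 @ w5) =
    (if w2 = [] \<or> w4 = [] then w1 @ w4 @ x # w2 @ w5 else w1 @ w2 @ x # w4 @ w5)"
proof -
  let ?p = "w1 @ w2 @ x # w4 @ w5"
  have asc: "double_ascent ?p x \<longleftrightarrow> w2 \<noteq> [] \<and> w4 = []"
    using double_ascent_iff[of "w1 @ w2" x "w4 @ w5"] dist w1 w2 w4 w5
    by (cases w2 rule: rev_cases; cases w4) auto
  have desc: "double_descent ?p x \<longleftrightarrow> w2 = [] \<and> w4 \<noteq> []"
    using double_descent_iff[of "w1 @ w2" x "w4 @ w5"] dist w1 w2 w4 w5
    by (cases w2 rule: rev_cases; cases w4) auto
  have nx: "\<forall>y \<in> set (w1 @ w2). y \<noteq> x" using dist by auto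
  have l: "takeWhile (\<lambda>y. y \<noteq> x) ?p = w1 @ w2"
    using takeWhile_append2[of "w1 @ w2" "\<lambda>y. y \<noteq> x" "x # w4 @ w5"] nx by simp
  have r: "dropWhile (\<lambda>y. y \<noteq> x) ?p = x # w4 @ w5"
    using dropWhile_append2[of "w1 @ w2" "\<lambda>y. y \<noteq> x" "x # w4 @ w5"] nx by simp
  have w1': "takeWhile (\<lambda>y. y < x) (rev w1) = []" "dropWhile (\<lambda>y. y < x) (rev w1) = rev w1"
    using w1 by (cases w1 rule: rev_cases; simp)+
  have w5': "takeWhile (\<lambda>y. y < x) w5 = []" "dropWhile (\<lambda>y. y < x) w5 = w5"
    using w5 by (cases w5; simp)+
  have left: "takeWhile (\<lambda>y. y < x) (rev (w1 @ w2)) = rev w2"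
      "dropWhile (\<lambda>y. y < x) (rev (w1 @ w2)) = rev w1"
    using takeWhile_append2[of "rev w2" "\<lambda>y. y < x" "rev w1"]
      dropWhile_append2[of "rev w2" "\<lambda>y. y < x" "rev w1"] w2 w1' by simp_all
  have right: "takeWhile (\<lambda>y. y < x) (w4 @ w5) = w4" "dropWhile (\<lambda>y. y < x) (w4 @ w5) = w5"
    using takeWhile_append2[of w4 "\<lambda>y. y < x" w5]
      dropWhile_append2[of w4 "\<lambda>y. y < x" w5] w4 w5' by simp_all
  show ?thesis
    unfolding hop_def asc desc Let_def l r left list.sel right by auto
qed

text \<open>
  The contexts \<open>as\<close> and \<open>bs\<close> make the induction go through: in a subtree, the neighbouring letters
  outside it are larger ancestors, which delimit the blocks around \<open>x\<close>.
\<close>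

lemma hop_inorder_context:
  assumes "decreasing t" "distinct (as @ inorder t @ bs)" "x \<in> set_tree t"
    and "as = [] \<or> (\<forall>y \<in> set_tree t. y < last as)"
    and "bs = [] \<or> (\<forall>y \<in> set_tree t. y < hd bs)"
  shows "hop x (as @ inorder t @ bs) = as @ inorder (flip {x} t) @ bs"
  using assms
proof (induction t arbitrary: as bs)
  case Leaf
  then show ?case by simp
next
  case (Node l z r)
  consider "x = z" | "x \<noteq> z" "x \<in> set_tree l" | "x \<noteq> z" "x \<in> set_tree r"
    using Node.prems(3) by auto
  then show ?case
  proof cases
    case 1
    have "x \<notin> set_tree l" "x \<notin> set_tree r"
      using 1 Node.prems(1) by auto
    then have sub: "flip {x} l = l" "flip {x} r = r" by (simp_all add: flip_disjoint)
    have "inorder l = [] \<longleftrightarrow> l = Leaf" "inorder r = [] \<longleftrightarrow> r = Leaf"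
      by (cases l; simp) (cases r; simp)
    then show ?thesis
      using hop_blocks[of as "inorder l" x "inorder r" bs] Node.prems 1 sub by auto
  next
    case 2
    have "x \<notin> set_tree r"
      using 2 Node.prems(2) by (auto simp flip: set_inorder)
    then have "flip {x} r = r" by (simp add: flip_disjoint)
    then show ?thesis
      using Node.IH(1)[of as "z # inorder r @ bs"] Node.prems 2 by auto
  next
    case 3
    have "x \<notin> set_tree l"
      using 3 Node.prems(2) by (auto simp flip: set_inorder)
    then have "flip {x} l = l" by (simp add: flip_disjoint)
    then show ?thesis
      using Node.IH(2)[of "as @ inorder l @ [z]" bs] Node.prems 3 by auto
  qed
qed

lemma hop_inorder:
  assumes "decreasing t" "distinct (inorder t)" "x \<in> set_tree t"
  shows "hop x (inorder t) = inorder (flip {x} t)"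
  using hop_inorder_context[of t "[]" "[]" x] assms by simp

lemma fold_hop_inorder:
  assumes "decreasing t" "distinct (inorder t)" "distinct xs" "set xs \<subseteq> set_tree t"
  shows "fold hop xs (inorder t) = inorder (flip (set xs) t)"
  using assms
proof (induction xs arbitrary: t)
  case Nil
  then show ?case by simp
next
  case (Cons x xs)
  have "(set xs - {x}) \<union> ({x} - set xs) = set (x # xs)"
    using Cons.prems(3) by auto
  then have "flip (set xs) (flip {x} t) = flip (set (x # xs)) t"
    by (simp only: flip_flip)
  then show ?case
    using Cons.IH[of "flip {x} t"] Cons.prems
    by (simp add: hop_inorder decreasing_flip distinct_inorder_flip)
qed

lemma hop_set_inorder:
  assumes "decreasing t" "distinct (inorder t)" "S \<subseteq> set_tree t"
  shows "hop_set S (inorder t) = inorder (flip S t)"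
proof -
  have "finite S" using finite_subset[OF assms(3)] by simp
  then show ?thesis
    unfolding hop_set_def using fold_hop_inorder[of t "sorted_list_of_set S"] assms by simp
qed

section \<open>Descents and right children\<close>

lemma descents_singleton [simp]: "descents [x] = {}"
  by (simp add: descents_def)

lemma descents_Nil [simp]: "descents [] = {}"
  by (simp add: descents_def)

lemma finite_descents [simp]: "finite (descents p)"
  by (simp add: descents_def)

lemma descents_Cons_Cons:
  "descents (x # y # zs) = (if x > y then {1} else {}) \<union> Suc ` descents (y # zs)"
proof (rule set_eqI)
  fix i
  show "i \<in> descents (x # y # zs) \<longleftrightarrow>
    i \<in> (if x > y then {1} else {}) \<union> Suc ` descents (y # zs)"
  proof (cases i)
    case 0
    then show ?thesis by (auto simp: descents_def)
  next
    case (Suc j)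
    have "Suc j \<in> Suc ` A \<longleftrightarrow> j \<in> A" for A by auto
    then show ?thesis
      unfolding Suc by (cases j) (auto simp: descents_def letter_def)
  qed
qed

lemma card_descents_Cons_Cons:
  "card (descents (x # y # zs)) = of_bool (x > y) + card (descents (y # zs))"
proof -
  have "1 \<notin> Suc ` descents (y # zs)" by (auto simp: descents_def)
  then show ?thesis by (simp add: descents_Cons_Cons card_image)
qed

lemma card_descents_append:
  assumes "xs \<noteq> []" "ys \<noteq> []"
  shows "card (descents (xs @ ys)) =
    card (descents xs) + of_bool (last xs > hd ys) + card (descents ys)"
  using assms(1)
proof (induction xs rule: induct_list012)
  case (2 x)
  then show ?case using assms(2) by (cases ys) (simp_all add: card_descents_Cons_Cons)
next
  case (3 x y zs)
  then show ?case by (simp add: card_descents_Cons_Cons)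
qed simp

fun right_children :: "'a tree \<Rightarrow> nat" where
  "right_children Leaf = 0"
| "right_children (Node l x r) = right_children l + right_children r + of_bool (r \<noteq> Leaf)"

lemma card_descents_inorder:
  "decreasing t \<Longrightarrow> card (descents (inorder t)) = right_children t"
proof (induction t)
  case Leaf
  then show ?case by simp
next
  case (Node l x r)
  have right: "card (descents (x # inorder r)) = right_children r + of_bool (r \<noteq> Leaf)"
  proof (cases "r = Leaf")
    case False
    then have ne: "inorder r \<noteq> []" by (cases r) auto
    then have "hd (inorder r) < x" using Node.prems hd_in_set[OF ne] by simp
    then show ?thesis
      using card_descents_append[of "[x]" "inorder r"] ne False Node by simp
  qed simp
  show ?case
  proof (cases "l = Leaf")
    case True
    then show ?thesis using right by simp
  next
    case False
    then have ne: "inorder l \<noteq> []" by (cases l) auto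
    then have "last (inorder l) < x" using Node.prems last_in_set[OF ne] by simp
    then show ?thesis
      using card_descents_append[of "inorder l" "x # inorder r"] ne right Node by simp
  qed
qed

text \<open>
  An only child is a right child either before or after the flip, and of two children
  exactly one is a right child both times.  So every edge is counted once.
\<close>

lemma right_children_flip:
  "set_tree t \<subseteq> S \<Longrightarrow> right_children t + right_children (flip S t) = size t - 1"
proof (induction t)
  case Leaf
  then show ?case by simp
next
  case (Node l x r)
  have "size l = 0 \<longleftrightarrow> l = Leaf" "size r = 0 \<longleftrightarrow> r = Leaf" by auto
  then show ?case using Node by (cases "size l"; cases "size r") auto
qed

section \<open>The other statistics in terms of descents\<close>

lemma card_ascents:
  assumes "distinct p"
  shows "card (ascents p) + card (descents p) = length p - 1"
proof -
  have "letter p i \<noteq> letter p (i + 1)" if "i \<in> {1..length p - 1}" for i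
    using that assms by (auto simp: letter_def nth_eq_iff_index_eq)
  then have "{1..length p - 1} = ascents p \<union> descents p"
    unfolding ascents_def descents_def by (force simp: neq_iff)
  moreover have "ascents p \<inter> descents p = {}" by (auto simp: ascents_def descents_def)
  moreover have "finite (ascents p)" by (simp add: ascents_def)
  ultimately show ?thesis
    using card_Un_disjoint[of "ascents p" "descents p"]
    by (metis card_atLeastAtMost diff_Suc_1 finite_descents One_nat_def)
qed

lemma descents_increasing: "sorted_wrt (<) p \<Longrightarrow> descents p = {}"
  by (auto simp: descents_def letter_def sorted_wrt_iff_nth_less dest!: less_imp_not_less)

lemma runs_increasing: "sorted_wrt (<) p \<Longrightarrow> runs p = {p}"
  unfolding runs_def by (auto intro: sublist_order.order.antisym)

lemma Nil_notin_runs: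
  assumes "p \<noteq> []"
  shows "[] \<notin> runs p"
proof
  assume "[] \<in> runs p"
  moreover have "sublist [hd p] p" using assms by (cases p) auto
  ultimately show False unfolding runs_def by (auto dest!: spec[of _ "[hd p]"])
qed

text \<open>An increasing subword cannot straddle a descent.\<close>

lemma increasing_sublist_append_iff:
  fixes xs ys w :: "nat list"
  assumes "xs \<noteq> []" "ys \<noteq> []" "last xs > hd ys" "sorted_wrt (<) w"
  shows "sublist w (xs @ ys) \<longleftrightarrow> sublist w xs \<or> sublist w ys"
proof
  assume "sublist w (xs @ ys)"
  moreover have "sublist w xs \<or> sublist w ys"
    if w: "w = u @ v" "suffix u xs" "prefix v ys" for u v
  proof (cases "u = [] \<or> v = []")
    case True
    then show ?thesis using w by auto
  next
    case False
    then have "last u = last xs" "hd v = hd ys"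
      using w by (auto simp: suffix_def prefix_def)
    moreover have "last u < hd v"
      using assms(4) w(1) False by (auto simp: sorted_wrt_append)
    ultimately show ?thesis using assms(3) by simp
  qed
  ultimately show "sublist w xs \<or> sublist w ys" by (auto simp: sublist_append)
qed (auto simp: sublist_append)

lemma runs_append:
  assumes dist: "distinct (xs @ ys)" and ne: "xs \<noteq> []" "ys \<noteq> []" and desc: "last xs > hd ys"
  shows "runs (xs @ ys) = runs xs \<union> runs ys" "runs xs \<inter> runs ys = {}"
proof -
  note sub = increasing_sublist_append_iff[OF ne desc]
  have nil: "[] \<notin> runs (xs @ ys)" "[] \<notin> runs xs" "[] \<notin> runs ys"
    using ne by (auto intro!: Nil_notin_runs)
  have both: "w = []" if "sublist w xs" "sublist w ys" for w
    using that dist set_mono_sublist[of w xs] set_mono_sublist[of w ys]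
    by (cases w) auto
  have both_ext: "w = []" if "sublist w xs" "sublist w v" "sublist v ys" for w v
    using both that sublist_order.order.trans by blast
  have both_ext': "w = []" if "sublist w ys" "sublist w v" "sublist v xs" for w v
    using both that sublist_order.order.trans by blast
  have in_runs: "w \<in> runs p \<longleftrightarrow> sublist w p \<and> sorted_wrt (<) w \<and>
      (\<forall>v. sorted_wrt (<) v \<longrightarrow> sublist v p \<longrightarrow> sublist w v \<longrightarrow> v = w)" for w p
    unfolding runs_def by auto
  show "runs xs \<inter> runs ys = {}"
  proof (rule equals0I)
    fix w assume w: "w \<in> runs xs \<inter> runs ys"
    then have "w = []" by (intro both) (auto simp: in_runs)
    then show False using w nil by simp
  qed
  show "runs (xs @ ys) = runs xs \<union> runs ys"
  proof (intro set_eqI iffI)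
    fix w assume w: "w \<in> runs (xs @ ys)"
    then have inc: "sorted_wrt (<) w" by (simp add: in_runs)
    have "sublist w xs \<or> sublist w ys" using w sub[OF inc] by (simp add: in_runs)
    moreover have "v = w" if "sorted_wrt (<) v" "sublist v xs \<or> sublist v ys" "sublist w v" for v
      using w that sub[OF that(1)] by (simp add: in_runs)
    ultimately show "w \<in> runs xs \<union> runs ys" using inc by (auto simp: in_runs)
  next
    fix w assume w: "w \<in> runs xs \<union> runs ys"
    then have inc: "sorted_wrt (<) w" and "w \<noteq> []" using nil by (auto simp: in_runs)
    have "v = w" if "sorted_wrt (<) v" "sublist v xs \<or> sublist v ys" "sublist w v" for v
      using w that both_ext[of w v] both_ext'[of w v] \<open>w \<noteq> []\<close> by (auto simp: in_runs)
    moreover have "sublist w xs \<or> sublist w ys" using w by (auto simp: in_runs)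
    ultimately show "w \<in> runs (xs @ ys)" using inc sub by (simp add: in_runs)
  qed
qed

lemma finite_runs: "finite (runs p)"
  by (rule finite_subset[of _ "set (sublists p)"]) (auto simp: runs_def)

lemma increasing_or_descent:
  fixes p :: "'a::linorder list"
  assumes "distinct p"
  shows "sorted_wrt (<) p \<or> (\<exists>xs ys. p = xs @ ys \<and> xs \<noteq> [] \<and> ys \<noteq> [] \<and> last xs > hd ys)"
proof (rule disjCI)
  assume none: "\<nexists>xs ys. p = xs @ ys \<and> xs \<noteq> [] \<and> ys \<noteq> [] \<and> last xs > hd ys"
  have "p ! i < p ! Suc i" if "Suc i < length p" for i
  proof -
    have "take (Suc i) p \<noteq> []" "drop (Suc i) p \<noteq> []"
      "last (take (Suc i) p) = p ! i" "hd (drop (Suc i) p) = p ! Suc i"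
      using that by (auto simp: take_Suc_conv_app_nth hd_drop_conv_nth)
    then have "\<not> p ! i > p ! Suc i"
      using none append_take_drop_id[of "Suc i" p] by metis
    moreover have "p ! i \<noteq> p ! Suc i" using that assms by (simp add: nth_eq_iff_index_eq)
    ultimately show ?thesis by (metis neq_iff)
  qed
  then show "sorted_wrt (<) p"
    by (simp add: sorted_wrt_iff_nth_Suc_transp)
qed

lemma card_runs:
  assumes "distinct p" "p \<noteq> []"
  shows "card (runs p) = card (descents p) + 1"
  using assms
proof (induction p rule: length_induct)
  case (1 p)
  show ?case
  proof (cases "sorted_wrt (<) p")
    case True
    then show ?thesis by (simp add: runs_increasing descents_increasing)
  next
    case False
    then obtain xs ys where p: "p = xs @ ys" "xs \<noteq> []" "ys \<noteq> []" "last xs > hd ys"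
      using increasing_or_descent "1.prems"(1) by blast
    have "card (runs xs) = card (descents xs) + 1" "card (runs ys) = card (descents ys) + 1"
      using "1.IH" "1.prems" p by auto
    moreover have "card (runs p) = card (runs xs) + card (runs ys)"
      using runs_append[of xs ys] "1.prems"(1) p by (simp add: card_Un_disjoint finite_runs)
    ultimately show ?thesis using card_descents_append[of xs ys] p by simp
  qed
qed

lemma tree_parent_append:
  assumes "v \<notin> set as"
  shows "tree_parent (as @ v # bs) v =
    (if filter (\<lambda>u. u < v) as = [] then 0 else last (filter (\<lambda>u. u < v) as))"
proof -
  have "takeWhile (\<lambda>u. u \<noteq> v) (as @ v # bs) = as"
    using takeWhile_append2[of as "\<lambda>u. u \<noteq> v" "v # bs"] assms by fastforce
  then show ?thesis by (simp add: tree_parent_def Let_def)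
qed

text \<open>
  If \<open>u\<close> is followed by a smaller letter, then that letter is a better candidate than \<open>u\<close> for
  the parent of any later letter above \<open>u\<close>.  If \<open>u\<close> is followed by a larger letter, that letter is a child.
\<close>

lemma ex_child_iff:
  assumes dist: "distinct (as @ u # bs)" and pos: "u > 0"
  shows "(\<exists>v \<in> set (as @ u # bs). tree_parent (as @ u # bs) v = u) \<longleftrightarrow> bs \<noteq> [] \<and> u < hd bs"
proof
  assume "bs \<noteq> [] \<and> u < hd bs"
  then obtain v cs where bs: "bs = v # cs" "u < v" by (cases bs) auto
  then have "tree_parent ((as @ [u]) @ v # cs) v = u"
    using dist by (subst tree_parent_append) auto
  then show "\<exists>v \<in> set (as @ u # bs). tree_parent (as @ u # bs) v = u" using bs by auto
next
  assume "\<exists>v \<in> set (as @ u # bs). tree_parent (as @ u # bs) v = u"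
  then obtain v where v: "v \<in> set (as @ u # bs)" "tree_parent (as @ u # bs) v = u" by blast
  then obtain xs ys where split: "as @ u # bs = xs @ v # ys" by (meson split_list)
  let ?s = "filter (\<lambda>w. w < v) xs"
  have "v \<notin> set xs" using dist unfolding split by simp
  then have s: "?s \<noteq> []" "last ?s = u"
    using v(2) pos tree_parent_append[of v xs ys] unfolding split by (auto split: if_splits)
  then have u: "u \<in> set xs" "u < v" using last_in_set[OF s(1)] by auto
  \<comment> \<open>As \<open>u\<close> precedes \<open>v\<close>, the word between them is an initial part of \<open>bs\<close>.\<close>
  then obtain cs where xs: "xs = as @ u # cs" and bs: "bs = cs @ v # ys"
  proof -
    obtain a c where ac: "xs = a @ u # c" using u(1) by (meson split_list)
    have eq: "as @ u # bs = a @ u # c @ v # ys" using split ac by simp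
    have "u \<notin> set as" "u \<notin> set bs" using dist by simp_all
    then have "as = a" "bs = c @ v # ys"
      using eq append_Cons_eq_iff[of u as bs a "c @ v # ys"] by simp_all
    then show ?thesis using that ac by blast
  qed
  show "bs \<noteq> [] \<and> u < hd bs"
  proof (cases cs)
    case Nil
    then show ?thesis using bs u by simp
  next
    case (Cons w ds)
    have "u \<noteq> w" using dist bs Cons by auto
    moreover have "\<not> w < u"
    proof
      assume "w < u"
      then have "last ?s \<in> set (w # ds)"
        using u(2) last_in_set[of "w # filter (\<lambda>w. w < v) ds"]
        unfolding xs Cons by (auto split: if_splits)
      then show False using s(2) dist bs Cons by auto
    qed
    ultimately show ?thesis using bs Cons by simp
  qed
qed

lemma tree_leaves_eq:
  assumes p: "p \<in> permutations_of_set {1..n}" and n: "n \<ge> 1"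
  shows "tree_leaves p = letter p ` insert n (descents p)"
proof -
  have set: "set p = {1..n}" and dist: "distinct p"
    using p by (auto simp: permutations_of_set_def)
  have len: "length p = n" using distinct_card[OF dist] set by simp
  have leaf: "u \<in> tree_leaves p \<longleftrightarrow> u \<in> {0..n} \<and> \<not> (\<exists>v \<in> set p. tree_parent p v = u)" for u
    unfolding tree_leaves_def tree_vertices_def tree_edges_def using len set by auto
  have "p \<noteq> []" using len n by auto
  then have "tree_parent p (hd p) = 0"
    using tree_parent_append[of "hd p" "[]" "tl p"] by simp
  then have "0 \<notin> tree_leaves p" using leaf \<open>p \<noteq> []\<close> by auto
  have letter_mem: "letter p i \<in> {1..n}" if "i \<in> {1..n}" for i
    using that nth_mem[of "i - 1" p] len set unfolding letter_def by auto
  have leaf_letter: "letter p i \<in> tree_leaves p \<longleftrightarrow> i \<in> insert n (descents p)"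
    if i: "i \<in> {1..n}" for i
  proof -
    have split: "p = take (i - 1) p @ letter p i # drop i p"
      using id_take_nth_drop[of "i - 1" p] i len by (cases i) (auto simp: letter_def)
    have "(\<exists>v \<in> set p. tree_parent p v = letter p i) \<longleftrightarrow>
        drop i p \<noteq> [] \<and> letter p i < hd (drop i p)"
      using ex_child_iff[of "take (i - 1) p" "letter p i" "drop i p", folded split, OF dist]
        letter_mem[OF i] by simp
    also have "\<dots> \<longleftrightarrow> i < n \<and> letter p i < letter p (i + 1)"
      using len by (auto simp: hd_drop_conv_nth letter_def)
    also have "\<dots> \<longleftrightarrow> i \<notin> insert n (descents p)"
    proof (cases "i < n")
      case True
      then have "letter p i \<noteq> letter p (i + 1)"
        using i dist len by (auto simp: letter_def nth_eq_iff_index_eq)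
      then show ?thesis using True i len by (auto simp: descents_def)
    qed (use i in auto)
    finally show ?thesis using leaf letter_mem[OF i] by auto
  qed
  have "insert n (descents p) \<subseteq> {1..n}" using n len by (auto simp: descents_def)
  moreover have "tree_leaves p \<subseteq> letter p ` {1..n}"
  proof
    fix u assume u: "u \<in> tree_leaves p"
    then have "u \<in> set p" using leaf[of u] \<open>0 \<notin> tree_leaves p\<close> set by (cases u) auto
    then obtain j where "j < n" "u = p ! j" using len by (auto simp: in_set_conv_nth)
    then show "u \<in> letter p ` {1..n}"
      by (intro image_eqI[of _ _ "Suc j"]) (auto simp: letter_def)
  qed
  ultimately show ?thesis using leaf_letter by blast
qed

lemma tree_width_eq:
  assumes p: "p \<in> permutations_of_set {1..n}" and n: "n \<ge> 1"
  shows "tree_width p = card (descents p) + 1"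
proof -
  have dist: "distinct p" using p by (auto simp: permutations_of_set_def)
  have len: "length p = n" using p distinct_card[OF dist] by (simp add: permutations_of_set_def)
  have "insert n (descents p) \<subseteq> {1..n}" using n len by (auto simp: descents_def)
  moreover have "inj_on (letter p) {1..n}"
    using dist len by (auto simp: inj_on_def letter_def nth_eq_iff_index_eq)
  ultimately have "inj_on (letter p) (insert n (descents p))" by (rule inj_on_subset[rotated])
  moreover have "n \<notin> descents p" using n len by (auto simp: descents_def)
  ultimately show ?thesis
    unfolding tree_width_def tree_leaves_eq[OF assms] by (simp add: card_image)
qed

section \<open>Averaging over an orbit\<close>

lemma homomesic_if_complementing_involution:
  assumes "\<And>x. x \<in> X \<Longrightarrow> finite (orbit x)" "\<And>x. x \<in> X \<Longrightarrow> orbit x \<noteq> {}"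
    and closed: "\<And>x y. x \<in> X \<Longrightarrow> y \<in> orbit x \<Longrightarrow> \<Phi> y \<in> orbit x"
    and invol: "\<And>x y. x \<in> X \<Longrightarrow> y \<in> orbit x \<Longrightarrow> \<Phi> (\<Phi> y) = y"
    and compl: "\<And>x y. x \<in> X \<Longrightarrow> y \<in> orbit x \<Longrightarrow> real (f y) + real (f (\<Phi> y)) = k"
  shows "homomesic X orbit f (k / 2)"
  unfolding homomesic_def
proof
  fix x assume x: "x \<in> X"
  have "(\<Sum>y\<in>orbit x. real (f y)) = (\<Sum>y\<in>orbit x. real (f (\<Phi> y)))"
    using x closed invol by (intro sum.reindex_bij_witness[of _ \<Phi> \<Phi>]) auto
  moreover have "(\<Sum>y\<in>orbit x. real (f y)) + (\<Sum>y\<in>orbit x. real (f (\<Phi> y))) =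
      k * real (card (orbit x))"
    using compl[OF x] by (simp flip: sum.distrib)
  moreover have "card (orbit x) > 0" using assms(1,2) x by (simp add: card_gt_0_iff)
  ultimately show "(\<Sum>y\<in>orbit x. real (f y)) / real (card (orbit x)) = k / 2"
    by (simp add: field_simps)
qed

lemma hop_orbit_eq_image: "hop_orbit n p = (\<lambda>S. hop_set S p) ` Pow {1..n}"
  unfolding hop_orbit_def by auto

text \<open>
  On trees, hopping \<open>S\<close> and then all letters amounts to hopping the complement of \<open>S\<close>; hence
  the hop of all letters maps each orbit to itself.
\<close>

lemma full_hop_on_orbit:
  assumes p: "p \<in> permutations_of_set {1..n}" and y: "y \<in> hop_orbit n p"
  shows "y \<in> permutations_of_set {1..n}"
    and "hop_set {1..n} y \<in> hop_orbit n p"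
    and "hop_set {1..n} (hop_set {1..n} y) = y"
    and "card (descents y) + card (descents (hop_set {1..n} y)) = n - 1"
proof -
  have "distinct p" using p by (simp add: permutations_of_set_def)
  then obtain t where t: "inorder t = p" "decreasing t" using ex_decreasing_tree by blast
  have dist: "distinct (inorder t)" and set: "set_tree t = {1..n}"
    using p t(1) by (auto simp: permutations_of_set_def simp flip: set_inorder)
  have orbit: "hop_orbit n p = (\<lambda>S. inorder (flip S t)) ` Pow {1..n}"
    unfolding hop_orbit_eq_image t(1)[symmetric]
    by (intro image_cong refl hop_set_inorder t(2) dist) (simp add: set)
  then obtain S where S: "S \<subseteq> {1..n}" "y = inorder (flip S t)" using y by blast
  let ?u = "flip S t"
  have u: "decreasing ?u" "distinct (inorder ?u)" "set_tree ?u = {1..n}"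
    using t(2) dist set by (auto simp: decreasing_flip distinct_inorder_flip)
  have full: "hop_set {1..n} y = inorder (flip {1..n} ?u)"
    using hop_set_inorder[OF u(1,2)] u(3) S(2) by simp
  show "y \<in> permutations_of_set {1..n}"
    using u S(2) by (simp add: permutations_of_set_def)
  show "hop_set {1..n} y \<in> hop_orbit n p"
    unfolding full orbit flip_flip using S(1) by (intro imageI) auto
  show "hop_set {1..n} (hop_set {1..n} y) = y"
    unfolding full using hop_set_inorder[of "flip {1..n} ?u" "{1..n}"] u S(2)
    by (simp add: decreasing_flip distinct_inorder_flip)
  have "size ?u = n"
    using distinct_card[OF u(2)] u(3) by simp
  then show "card (descents y) + card (descents (hop_set {1..n} y)) = n - 1"
    using right_children_flip[of ?u "{1..n}"] u(3)
      card_descents_inorder[OF u(1)] card_descents_inorder[OF decreasing_flip[OF u(1)]]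
    unfolding full unfolding S(2) by simp
qed

theorem theorem4p11:
  fixes n :: nat
  assumes "n \<ge> 1"
  shows "homomesic (permutations_of_set {1..n}) (hop_orbit n)
           (\<lambda>\<pi>. card (descents \<pi>)) ((real n - 1) / 2) \<and>
         homomesic (permutations_of_set {1..n}) (hop_orbit n)
           (\<lambda>\<pi>. card (ascents \<pi>)) ((real n - 1) / 2) \<and>
         homomesic (permutations_of_set {1..n}) (hop_orbit n)
           tree_width ((real n + 1) / 2) \<and>
         homomesic (permutations_of_set {1..n}) (hop_orbit n)
           (\<lambda>\<pi>. card (runs \<pi>)) ((real n + 1) / 2)"
proof -
  let ?P = "permutations_of_set {1..n}" and ?\<Phi> = "hop_set {1..n}"
  have transfer: "homomesic ?P (hop_orbit n) f (k / 2)"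
    if "\<And>y. y \<in> ?P \<Longrightarrow> ?\<Phi> y \<in> ?P \<Longrightarrow> card (descents y) + card (descents (?\<Phi> y)) = n - 1 \<Longrightarrow>
      real (f y) + real (f (?\<Phi> y)) = k" for f k
  proof (rule homomesic_if_complementing_involution[where \<Phi> = ?\<Phi>])
    fix p y assume p: "p \<in> ?P" and y: "y \<in> hop_orbit n p"
    note full = full_hop_on_orbit[OF p]
    show "?\<Phi> y \<in> hop_orbit n p" "?\<Phi> (?\<Phi> y) = y" by (rule full[OF y])+
    show "real (f y) + real (f (?\<Phi> y)) = k"
      using that full(1)[OF y] full(1)[OF full(2)[OF y]] full(4)[OF y] by blast
  qed (auto simp: hop_orbit_eq_image)
  have perm: "distinct y" "length y = n" if "y \<in> ?P" for y
    using that distinct_card[of y] by (auto simp: permutations_of_set_def)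
  show ?thesis
  proof (intro conjI)
    show "homomesic ?P (hop_orbit n) (\<lambda>\<pi>. card (descents \<pi>)) ((real n - 1) / 2)"
      using assms by (intro transfer) (simp add: of_nat_diff flip: of_nat_add)
    show "homomesic ?P (hop_orbit n) (\<lambda>\<pi>. card (ascents \<pi>)) ((real n - 1) / 2)"
    proof (rule transfer)
      fix y assume y: "y \<in> ?P" "?\<Phi> y \<in> ?P"
        and des: "card (descents y) + card (descents (?\<Phi> y)) = n - 1"
      have "card (ascents y) + card (ascents (?\<Phi> y)) = n - 1"
        using card_ascents[of y] card_ascents[of "?\<Phi> y"] perm[OF y(1)] perm[OF y(2)] des
        by simp
      then show "real (card (ascents y)) + real (card (ascents (?\<Phi> y))) = real n - 1"
        using assms by (simp add: of_nat_diff flip: of_nat_add)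
    qed
    show "homomesic ?P (hop_orbit n) tree_width ((real n + 1) / 2)"
    proof (rule transfer)
      fix y assume y: "y \<in> ?P" "?\<Phi> y \<in> ?P"
        and des: "card (descents y) + card (descents (?\<Phi> y)) = n - 1"
      show "real (tree_width y) + real (tree_width (?\<Phi> y)) = real n + 1"
        using des assms tree_width_eq[OF y(1)] tree_width_eq[OF y(2)] by linarith
    qed
    show "homomesic ?P (hop_orbit n) (\<lambda>\<pi>. card (runs \<pi>)) ((real n + 1) / 2)"
    proof (rule transfer)
      fix y assume y: "y \<in> ?P" "?\<Phi> y \<in> ?P"
        and des: "card (descents y) + card (descents (?\<Phi> y)) = n - 1"
      have "y \<noteq> []" "?\<Phi> y \<noteq> []" using perm(2)[OF y(1)] perm(2)[OF y(2)] assms by auto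
      then show "real (card (runs y)) + real (card (runs (?\<Phi> y))) = real n + 1"
        using des assms card_runs[OF perm(1)[OF y(1)]] card_runs[OF perm(1)[OF y(2)]]
        by linarith
    qed
  qed
qed

end
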